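(* Let $\rho>0$ and $x\in\mathbb{R}^n_\downarrow$, let $A_{\rho,x}:=2ee^\top-\rho xx^\top$, and set $k=\mu(\rho,x)$. Consider the optimization problem $$(\ast)\qquad \min\left\{\tfrac12 w^\top A_{\rho,x}w: w\in\mathbb{S}^{n-1}_+\right\}.$$ Then the following statements hold. (i) If $k=0$, then $e_1$ is a global minimizer of $(\ast)$. (ii) If $1\le k\le n$, then the vector $\begin{bmatrix}\tilde w^\star\\ 0_{(n-k)\times1}\end{bmatrix}$ is a global minimizer of $(\ast)$, where $\tilde w^\star$ is a minimizer of the problem $\min_{w\in\mathbb{S}^{k-1}_+}\frac12 w^\top A_{\rho,x_{[k]}}w$ and $A_{\rho,x_{[k]}}$ is the $k$-order leading principal submatrix of $A_{\rho,x}$, obtained by removing its last $n-k$ rows and columns.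
   Context: $e\in\mathbb{R}^n$ is the all-ones vector and $e_1$ the first standard basis vector. $\mathbb{R}^n_\downarrow=\{x\in\mathbb{R}^n:x_1\ge\dots\ge x_n\ge0\}$. $\mathbb{S}^{m-1}_+$ is the set of vectors in $\mathbb{R}^m$ of Euclidean norm $1$ with nonnegative entries. The integer $\mu(\rho,x)$ is defined by: $\mu(\rho,x)=0$ if $(A_{\rho,x})_{11}\ge0$; $\mu(\rho,x)=k$ if there exists $1\le k<n$ such that $(A_{\rho,x})_{1k}<0$ and $(A_{\rho,x})_{1(k+1)}\ge0$; and $\mu(\rho,x)=n$ if $(A_{\rho,x})_{1n}<0$. Here $(A_{\rho,x})_{1j}=2-\rho x_1x_j$, which is nondecreasing in $j$, so $\mu(\rho,x)$ is the number of negative components of $2e-\rho x_1x$. *)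

theory Defs
  imports Complex_Main "Jordan_Normal_Form.Matrix" "Jordan_Normal_Form.DL_Submatrix"
begin

text \<open>Vectors and matrices are those of \<^theory>\<open>Jordan_Normal_Form.Matrix\<close>; indices start
  at 0, so the entry with 1-based position \<open>(1, j)\<close> is \<open>A $$ (0, j - 1)\<close>.\<close>

definition ones_vec :: "nat \<Rightarrow> real vec" where
  "ones_vec n = vec n (\<lambda>_. 1)"

definition outer_prod :: "real vec \<Rightarrow> real vec \<Rightarrow> real mat" where
  "outer_prod v w = mat (dim_vec v) (dim_vec w) (\<lambda>(i, j). v $ i * w $ j)"

definition A_mat :: "real \<Rightarrow> real vec \<Rightarrow> real mat" where
  "A_mat \<rho> x =
     2 \<cdot>\<^sub>m outer_prod (ones_vec (dim_vec x)) (ones_vec (dim_vec x)) - \<rho> \<cdot>\<^sub>m outer_prod x x"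

definition Rdown :: "nat \<Rightarrow> real vec set" where
  "Rdown n = {x \<in> carrier_vec n.
     (\<forall>i j. i \<le> j \<and> j < n \<longrightarrow> x $ j \<le> x $ i) \<and> (\<forall>i<n. 0 \<le> x $ i)}"

text \<open>The sphere \<open>S\<^sup>m\<^sup>-\<^sup>1\<close> intersected with the nonnegative orthant; the parameter is the
  dimension \<open>m\<close> of the ambient space.\<close>

definition nonneg_sphere :: "nat \<Rightarrow> real vec set" where
  "nonneg_sphere m = {w \<in> carrier_vec m. sqrt (w \<bullet> w) = 1 \<and> (\<forall>i<m. 0 \<le> w $ i)}"

definition half_quad :: "real mat \<Rightarrow> real vec \<Rightarrow> real" where
  "half_quad A w = 1 / 2 * (w \<bullet> (A *\<^sub>v w))"

text \<open>Meant for \<open>x \<in> Rdown n\<close> with \<open>n > 0\<close> and \<open>\<rho> > 0\<close>: then the first row of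
  \<open>A_mat \<rho> x\<close> is nondecreasing, so the index described by \<open>THE\<close> is unique and exactly one
  of the three cases applies.\<close>

definition mu :: "real \<Rightarrow> real vec \<Rightarrow> nat" where
  "mu \<rho> x =
     (let n = dim_vec x; A = A_mat \<rho> x in
      if A $$ (0, 0) \<ge> 0 then 0
      else if A $$ (0, n - 1) < 0 then n
      else (THE k. 1 \<le> k \<and> k < n \<and> A $$ (0, k - 1) < 0 \<and> A $$ (0, k) \<ge> 0))"

definition leading_principal_submatrix :: "real mat \<Rightarrow> nat \<Rightarrow> real mat" where
  "leading_principal_submatrix A k = submatrix A {..<k} {..<k}"

abbreviation global_minimizer :: "('a \<Rightarrow> real) \<Rightarrow> 'a set \<Rightarrow> 'a \<Rightarrow> bool" where
  "global_minimizer f S w \<equiv> is_arg_min f (\<lambda>v. v \<in> S) w"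

lemma A_mat_carrier: "A_mat \<rho> x \<in> carrier_mat (dim_vec x) (dim_vec x)"
  by (auto simp: A_mat_def outer_prod_def)

lemma A_mat_index:
  "i < dim_vec x \<Longrightarrow> j < dim_vec x \<Longrightarrow> A_mat \<rho> x $$ (i, j) = 2 - \<rho> * x $ i * x $ j"
  by (simp add: A_mat_def outer_prod_def ones_vec_def)

lemma leading_principal_submatrix_A_mat:
  assumes "k \<le> dim_vec x"
  shows "leading_principal_submatrix (A_mat \<rho> x) k = A_mat \<rho> (vec_first x k)"
proof -
  have dims: "dim_row (A_mat \<rho> x) = dim_vec x" "dim_col (A_mat \<rho> x) = dim_vec x"
    using A_mat_carrier[of \<rho> x] by auto
  have eq: "{i. i < dim_vec x \<and> i \<in> {..<k}} = {..<k}" using assms by auto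
  have pick: "pick {..<k} i = i" if "i < k" for i
  proof -
    have "{a \<in> {..<k}. a < i} = {..<i}" using that by auto
    then show ?thesis using pick_card_in_set[of i "{..<k}"] that by simp
  qed
  show ?thesis
  proof (rule eq_matI)
    fix i j
    assume "i < dim_row (A_mat \<rho> (vec_first x k))" "j < dim_col (A_mat \<rho> (vec_first x k))"
    then have ij: "i < k" "j < k" using A_mat_carrier[of \<rho> "vec_first x k"] by auto
    have "submatrix (A_mat \<rho> x) {..<k} {..<k} $$ (i, j) =
        A_mat \<rho> x $$ (pick {..<k} i, pick {..<k} j)"
      by (rule submatrix_index) (simp_all only: dims eq card_lessThan ij)
    then show "leading_principal_submatrix (A_mat \<rho> x) k $$ (i, j) =
        A_mat \<rho> (vec_first x k) $$ (i, j)"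
      using assms ij
      by (simp add: leading_principal_submatrix_def pick A_mat_index vec_first_def)
  next
    show "dim_row (leading_principal_submatrix (A_mat \<rho> x) k) = dim_row (A_mat \<rho> (vec_first x k))"
      using A_mat_carrier[of \<rho> "vec_first x k"]
      by (simp only: leading_principal_submatrix_def dim_submatrix dims eq card_lessThan
          carrier_matD dim_vec_first)
  next
    show "dim_col (leading_principal_submatrix (A_mat \<rho> x) k) = dim_col (A_mat \<rho> (vec_first x k))"
      using A_mat_carrier[of \<rho> "vec_first x k"]
      by (simp only: leading_principal_submatrix_def dim_submatrix dims eq card_lessThan
          carrier_matD dim_vec_first)
  qed
qed

lemma mu_eq_card:
  assumes "\<rho> > 0" "n > 0" and x: "x \<in> Rdown n"
  shows "mu \<rho> x = card {j. j < n \<and> 2 - \<rho> * x $ 0 * x $ j < 0}" (is "_ = card ?N")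
proof -
  define a where "a j = 2 - \<rho> * x $ 0 * x $ j" for j
  have n: "dim_vec x = n" using x by (auto simp: Rdown_def)
  have ent: "A_mat \<rho> x $$ (0, j) = a j" if "j < n" for j
    using that n by (simp add: A_mat_index a_def)
  have mono: "a i \<le> a j" if "i \<le> j" "j < n" for i j
  proof -
    have "x $ j \<le> x $ i" "0 \<le> x $ 0" using x that by (auto simp: Rdown_def)
    then show ?thesis using \<open>\<rho> > 0\<close> by (simp add: a_def mult_left_mono)
  qed
  consider "a 0 \<ge> 0" | "a 0 < 0" "a (n - 1) < 0" | "a 0 < 0" "a (n - 1) \<ge> 0" by linarith
  then show ?thesis
  proof cases
    case 1
    then have "?N = {}" using mono[of 0] by (force simp: a_def)
    then show ?thesis using 1 ent[of 0] \<open>n > 0\<close> by (simp add: mu_def Let_def)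
  next
    case 2
    have "a j < 0" if "j < n" for j
      using mono[of j "n - 1"] that 2(2) by linarith
    then have "?N = {..<n}" by (auto simp: a_def)
    then show ?thesis using 2 ent[of 0] ent[of "n - 1"] \<open>n > 0\<close> n by (simp add: mu_def Let_def)
  next
    case 3
    define k where "k = (LEAST j. a j \<ge> 0)"
    have k0: "a k \<ge> 0" unfolding k_def by (rule LeastI[of _ "n - 1"]) (rule 3(2))
    have "k \<le> n - 1" unfolding k_def by (rule Least_le) (rule 3(2))
    then have kn: "k < n" using \<open>n > 0\<close> by linarith
    have less: "a j < 0" if "j < k" for j
      using not_less_Least[of j "\<lambda>j. a j \<ge> 0"] that by (simp add: k_def)
    have k1: "1 \<le> k" using k0 3(1) by (cases k) auto
    have N: "?N = {..<k}"
    proof (intro equalityI subsetI)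
      fix j assume "j \<in> ?N"
      then have "j < n" "a j < 0" by (auto simp: a_def)
      then show "j \<in> {..<k}" using mono[of k j] k0 by (cases "j < k") auto
    qed (use less kn in \<open>auto simp: a_def\<close>)
    have "(THE k. 1 \<le> k \<and> k < n \<and> A_mat \<rho> x $$ (0, k - 1) < 0 \<and> A_mat \<rho> x $$ (0, k) \<ge> 0) = k"
    proof (rule the_equality)
      show "1 \<le> k \<and> k < n \<and> A_mat \<rho> x $$ (0, k - 1) < 0 \<and> A_mat \<rho> x $$ (0, k) \<ge> 0"
        using k0 k1 kn less[of "k - 1"] ent[of k] ent[of "k - 1"] by simp
    next
      fix l
      assume l: "1 \<le> l \<and> l < n \<and> A_mat \<rho> x $$ (0, l - 1) < 0 \<and> A_mat \<rho> x $$ (0, l) \<ge> 0"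
      then have "a (l - 1) < 0" "a l \<ge> 0" using ent[of l] ent[of "l - 1"] by auto
      then have "\<not> l < k" "\<not> k \<le> l - 1"
        using less[of l] mono[of k "l - 1"] k0 l by (linarith, fastforce)
      then show "l = k" by linarith
    qed
    then show ?thesis
      using 3 N ent[of 0] ent[of "n - 1"] \<open>n > 0\<close> n by (simp add: mu_def Let_def)
  qed
qed

end

theory Submission
  imports Defs
begin

text \<open>Every entry of \<open>A\<close> dominates the entry of the first row in the same column (and, by
  symmetry, in the same row), so all entries in a row or column of index at least
  \<open>k = mu \<rho> x\<close> are nonnegative.
  For \<open>k = 0\<close> the off-diagonal terms can be dropped from the quadratic form, and the smallest
  diagonal entry is the first one.
  For \<open>k \<ge> 1\<close> truncating a nonnegative vector to its first \<open>k\<close> coordinates does not increase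
  the form. The truncation \<open>p\<close> has norm at most 1, and by homogeneity its value is at least
  \<open>m * |p|\<^sup>2\<close> with \<open>m\<close> the minimum of the truncated problem. Since \<open>m \<le> A $$ (0, 0) / 2 < 0\<close>,
  this is at least \<open>m\<close>.\<close>

text \<open>The double sum lets quadratic forms be compared term by term, according to the signs of
  single entries.\<close>

lemma half_quad_eq_sum:
  assumes "A \<in> carrier_mat n n" "w \<in> carrier_vec n"
  shows "half_quad A w = (\<Sum>i<n. \<Sum>j<n. A $$ (i, j) * (w $ i * w $ j)) / 2"
proof -
  have "w \<bullet> (A *\<^sub>v w) = (\<Sum>i<n. w $ i * (\<Sum>j<n. A $$ (i, j) * w $ j))"
    using assms by (auto simp: scalar_prod_def row_def atLeast0LessThan intro!: sum.cong)
  also have "\<dots> = (\<Sum>i<n. \<Sum>j<n. A $$ (i, j) * (w $ i * w $ j))"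
    by (simp add: sum_distrib_left mult_ac)
  finally show ?thesis by (simp add: half_quad_def)
qed

lemma nonneg_sphere_iff:
  "w \<in> nonneg_sphere n \<longleftrightarrow> w \<in> carrier_vec n \<and> (\<Sum>i<n. (w $ i)\<^sup>2) = 1 \<and> (\<forall>i<n. 0 \<le> w $ i)"
  by (auto simp: nonneg_sphere_def scalar_prod_def atLeast0LessThan power2_eq_square)

lemma unit_vec_nonneg_sphere: "i < n \<Longrightarrow> unit_vec n i \<in> nonneg_sphere n"
  by (simp add: nonneg_sphere_def)

lemma half_quad_unit_vec:
  assumes "A \<in> carrier_mat n n" "i < n"
  shows "half_quad A (unit_vec n i) = A $$ (i, i) / 2"
  using assms by (simp add: half_quad_def scalar_prod_left_unit)

lemma half_quad_smult:
  assumes "A \<in> carrier_mat n n" "w \<in> carrier_vec n"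
  shows "half_quad A (c \<cdot>\<^sub>v w) = c\<^sup>2 * half_quad A w"
proof -
  have "(\<Sum>i<n. \<Sum>j<n. A $$ (i, j) * ((c \<cdot>\<^sub>v w) $ i * (c \<cdot>\<^sub>v w) $ j)) =
      c\<^sup>2 * (\<Sum>i<n. \<Sum>j<n. A $$ (i, j) * (w $ i * w $ j))"
    using assms
    by (auto simp: sum_distrib_left power2_eq_square mult_ac intro!: sum.cong)
  then show ?thesis using assms by (simp add: half_quad_eq_sum)
qed

text \<open>The normalised vector \<open>p\<close> / |\<open>p\<close>| is feasible, so its value is
  at least that of \<open>u\<close>; multiplying by |\<open>p\<close>| squared gives the bound,
  since the form is homogeneous of degree 2. The zero vector cannot be normalised, but then both
  sides vanish.\<close>

lemma half_quad_ge_of_minimizer: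
  assumes A: "A \<in> carrier_mat k k"
    and min: "global_minimizer (half_quad A) (nonneg_sphere k) u"
    and p: "p \<in> carrier_vec k" "\<And>i. i < k \<Longrightarrow> 0 \<le> p $ i"
  shows "half_quad A u * (\<Sum>i<k. (p $ i)\<^sup>2) \<le> half_quad A p"
proof (cases "(\<Sum>i<k. (p $ i)\<^sup>2) = 0")
  case True
  then have "\<forall>i<k. p $ i = 0" by (simp add: sum_nonneg_eq_0_iff)
  then have "half_quad A p = 0" using A p by (simp add: half_quad_eq_sum)
  then show ?thesis using True by simp
next
  case False
  define s where "s = (\<Sum>i<k. (p $ i)\<^sup>2)"
  have s: "s > 0" using False sum_nonneg[of "{..<k}" "\<lambda>i. (p $ i)\<^sup>2"] by (simp add: s_def)
  define v where "v = (1 / sqrt s) \<cdot>\<^sub>v p"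
  have "(\<Sum>i<k. (v $ i)\<^sup>2) = (\<Sum>i<k. (p $ i)\<^sup>2 / s)"
    using p s by (auto simp: v_def power_divide intro!: sum.cong)
  also have "\<dots> = 1" using s by (simp add: sum_divide_distrib[symmetric] s_def)
  finally have "v \<in> nonneg_sphere k"
    using p s by (simp add: nonneg_sphere_iff v_def)
  then have "half_quad A u \<le> half_quad A v"
    using min by (auto simp: is_arg_min_def not_less)
  also have "\<dots> = half_quad A p / s"
    using A p s by (simp add: v_def half_quad_smult power_divide)
  finally show ?thesis using s by (simp add: s_def[symmetric] field_simps)
qed

lemma global_minimizer_unit_vec:
  assumes A: "A \<in> carrier_mat n n" and "0 < n"
    and ge: "\<And>i j. i < n \<Longrightarrow> j < n \<Longrightarrow> 0 \<le> A $$ (i, j)"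
    and diag: "\<And>i. i < n \<Longrightarrow> A $$ (0, 0) \<le> A $$ (i, i)"
  shows "global_minimizer (half_quad A) (nonneg_sphere n) (unit_vec n 0)"
proof -
  have "A $$ (0, 0) / 2 \<le> half_quad A v" if v: "v \<in> nonneg_sphere n" for v
  proof -
    have v': "v \<in> carrier_vec n" "(\<Sum>i<n. (v $ i)\<^sup>2) = 1" "\<And>i. i < n \<Longrightarrow> 0 \<le> v $ i"
      using v by (auto simp: nonneg_sphere_iff)
    \<comment> \<open>The squares of the entries of \<open>v\<close> are weights with sum 1, so the
      diagonal part of the form is a weighted mean of diagonal entries.\<close>
    have "A $$ (0, 0) = (\<Sum>i<n. A $$ (0, 0) * (v $ i)\<^sup>2)"
      by (simp add: v' sum_distrib_left[symmetric])
    also have "\<dots> \<le> (\<Sum>i<n. A $$ (i, i) * (v $ i * v $ i))"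
      using diag by (auto simp: power2_eq_square intro!: sum_mono mult_right_mono)
    \<comment> \<open>In row \<open>i\<close> the diagonal term is one summand among nonnegative
      ones.\<close>
    also have "\<dots> \<le> (\<Sum>i<n. \<Sum>j<n. A $$ (i, j) * (v $ i * v $ j))"
      using ge v' by (intro sum_mono member_le_sum) auto
    finally show ?thesis using A v' by (simp add: half_quad_eq_sum)
  qed
  then show ?thesis
    using assms by (auto simp: is_arg_min_def unit_vec_nonneg_sphere half_quad_unit_vec not_less)
qed

lemma global_minimizer_append_zero:
  assumes A: "A \<in> carrier_mat n n" and B: "B \<in> carrier_mat k k" and k: "1 \<le> k" "k \<le> n"
    and BA: "\<And>i j. i < k \<Longrightarrow> j < k \<Longrightarrow> B $$ (i, j) = A $$ (i, j)"
    and neg: "A $$ (0, 0) < 0"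
    and ge: "\<And>i j. i < n \<Longrightarrow> j < n \<Longrightarrow> k \<le> i \<or> k \<le> j \<Longrightarrow> 0 \<le> A $$ (i, j)"
    and min: "global_minimizer (half_quad B) (nonneg_sphere k) w"
  shows "global_minimizer (half_quad A) (nonneg_sphere n) (w @\<^sub>v 0\<^sub>v (n - k))" (is "is_arg_min _ _ ?w")
proof -
  have w: "w \<in> carrier_vec k" "(\<Sum>i<k. (w $ i)\<^sup>2) = 1" "\<And>i. i < k \<Longrightarrow> 0 \<le> w $ i"
    using min by (auto simp: is_arg_min_def nonneg_sphere_iff)
  have wc: "?w \<in> carrier_vec n"
    using append_carrier_vec[OF w(1) zero_carrier_vec[of "n - k"]] k by simp
  have wi: "?w $ i = (if i < k then w $ i else 0)" if "i < n" for i
    using w k that by (auto simp: index_append_vec)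
  have restrict: "(\<Sum>i<n. if i < k then f i else 0) = (\<Sum>i<k. f i)" for f :: "nat \<Rightarrow> real"
  proof -
    have "{..<n} \<inter> {i. i < k} = {..<k}" using k by auto
    then show ?thesis by (simp add: sum.If_cases)
  qed
  \<comment> \<open>The form of the truncated vector is spread over all index pairs below
    \<open>n\<close>, with zeros outside the leading block, so that it can be compared termwise with
    the full form.\<close>
  have trunc: "(\<Sum>i<n. \<Sum>j<n. if i < k \<and> j < k then A $$ (i, j) * (u $ i * u $ j) else 0) =
      2 * half_quad B (vec k (\<lambda>i. u $ i))" for u :: "real vec"
  proof -
    have "(\<Sum>i<n. \<Sum>j<n. if i < k \<and> j < k then A $$ (i, j) * (u $ i * u $ j) else 0) =
      (\<Sum>i<n. if i < k then (\<Sum>j<n. if j < k then A $$ (i, j) * (u $ i * u $ j) else 0) else 0)"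
      by (intro sum.cong) auto
    also have "\<dots> = (\<Sum>i<k. \<Sum>j<k. A $$ (i, j) * (u $ i * u $ j))"
      by (simp add: restrict)
    finally show ?thesis using B BA by (simp add: half_quad_eq_sum[of _ k])
  qed
  have "(\<Sum>i<n. (?w $ i)\<^sup>2) = (\<Sum>i<n. if i < k then (w $ i)\<^sup>2 else 0)"
    by (intro sum.cong) (auto simp: wi)
  also have "\<dots> = 1" using w by (simp add: restrict)
  finally have ws: "?w \<in> nonneg_sphere n"
    using wc w by (simp add: nonneg_sphere_iff wi)
  have "vec k (\<lambda>i. ?w $ i) = w" using w wi k by (intro eq_vecI) auto
  moreover have "2 * half_quad A ?w =
      (\<Sum>i<n. \<Sum>j<n. if i < k \<and> j < k then A $$ (i, j) * (?w $ i * ?w $ j) else 0)"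
    unfolding half_quad_eq_sum[OF A wc] by (auto simp: wi intro!: sum.cong)
  ultimately have val: "half_quad A ?w = half_quad B w" by (simp add: trunc)
  \<comment> \<open>The first unit vector is feasible because 1 \<le> \<open>k\<close>; its value is
    half of a negative entry, hence the minimum is negative.\<close>
  have "half_quad B w \<le> half_quad B (unit_vec k 0)"
    using min unit_vec_nonneg_sphere[of 0 k] k by (auto simp: is_arg_min_def not_less)
  then have m: "half_quad B w < 0"
    using half_quad_unit_vec[OF B, of 0] BA[of 0 0] neg k by simp
  have "half_quad B w \<le> half_quad A v" if v: "v \<in> nonneg_sphere n" for v
  proof -
    have v': "v \<in> carrier_vec n" "(\<Sum>i<n. (v $ i)\<^sup>2) = 1" "\<And>i. i < n \<Longrightarrow> 0 \<le> v $ i"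
      using v by (auto simp: nonneg_sphere_iff)
    define p where "p = vec k (\<lambda>i. v $ i)"
    have "(\<Sum>i<k. (p $ i)\<^sup>2) = (\<Sum>i<k. (v $ i)\<^sup>2)" by (simp add: p_def)
    also have "\<dots> \<le> (\<Sum>i<n. (v $ i)\<^sup>2)" using k by (intro sum_mono2) auto
    finally have "(\<Sum>i<k. (p $ i)\<^sup>2) \<le> 1" using v' by simp
    \<comment> \<open>Multiplying a negative number by a factor of at most 1 does not decrease
      it.\<close>
    then have "half_quad B w \<le> half_quad B w * (\<Sum>i<k. (p $ i)\<^sup>2)"
      using m mult_left_mono_neg[of "\<Sum>i<k. (p $ i)\<^sup>2" 1 "half_quad B w"] by simp
    also have "\<dots> \<le> half_quad B p"
      using v' k by (intro half_quad_ge_of_minimizer B min) (auto simp: p_def)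
    also have "2 * half_quad B p \<le> 2 * half_quad A v"
    proof -
      have "2 * half_quad B p =
          (\<Sum>i<n. \<Sum>j<n. if i < k \<and> j < k then A $$ (i, j) * (v $ i * v $ j) else 0)"
        by (simp add: trunc p_def)
      \<comment> \<open>Terms inside the leading block agree; those outside are nonnegative by
        \<open>ge\<close> and the signs of \<open>v\<close>.\<close>
      also have "\<dots> \<le> (\<Sum>i<n. \<Sum>j<n. A $$ (i, j) * (v $ i * v $ j))"
        using ge v' by (intro sum_mono) (auto simp: not_less)
      finally show ?thesis using A v' by (simp add: half_quad_eq_sum)
    qed
    then have "half_quad B p \<le> half_quad A v" by simp
    finally show ?thesis .
  qed
  then show ?thesis using ws val by (auto simp: is_arg_min_def not_less)
qed

text \<open>The entries are 2 - \<rho> \<open>x $ i * x $ j\<close>, and the product shrinks as the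
  indices grow because \<open>x\<close> is nonnegative and nonincreasing.\<close>

lemma A_mat_mono:
  assumes "\<rho> > 0" "x \<in> Rdown n" "i' \<le> i" "i < n" "j' \<le> j" "j < n"
  shows "A_mat \<rho> x $$ (i', j') \<le> A_mat \<rho> x $$ (i, j)"
proof -
  have "x $ i * x $ j \<le> x $ i' * x $ j'"
    using assms by (intro mult_mono) (auto simp: Rdown_def)
  then have "\<rho> * (x $ i * x $ j) \<le> \<rho> * (x $ i' * x $ j')"
    using \<open>\<rho> > 0\<close> by simp
  then show ?thesis
    using assms by (auto simp: A_mat_index Rdown_def mult.assoc)
qed

text \<open>The columns with a negative entry in the first row form an initial segment by
  monotonicity, and \<open>mu\<close> is its length. With indices from 0, a negative column
  \<open>j\<close> puts the \<open>j\<close> + 1 indices of \<open>{..j}\<close> into the segment;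
  otherwise the segment lies in \<open>{..<j}\<close>.\<close>

lemma less_mu_iff:
  assumes "\<rho> > 0" "n > 0" "x \<in> Rdown n" "j < n"
  shows "j < mu \<rho> x \<longleftrightarrow> A_mat \<rho> x $$ (0, j) < 0"
proof -
  define N where "N = {j. j < n \<and> A_mat \<rho> x $$ (0, j) < 0}"
  have "N = {j. j < n \<and> 2 - \<rho> * x $ 0 * x $ j < 0}"
    using assms by (auto simp: N_def A_mat_index Rdown_def)
  then have mu: "mu \<rho> x = card N" using mu_eq_card[OF assms(1-3)] by simp
  have mono: "A_mat \<rho> x $$ (0, i) \<le> A_mat \<rho> x $$ (0, l)" if "i \<le> l" "l < n" for i l
    using assms that by (intro A_mat_mono) auto
  show ?thesis
  proof (cases "A_mat \<rho> x $$ (0, j) < 0")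
    case True
    have "{..j} \<subseteq> N"
    proof
      fix i assume "i \<in> {..j}"
      then show "i \<in> N" using mono[of i j] True assms by (auto simp: N_def)
    qed
    then have "card {..j} \<le> card N" by (rule card_mono[rotated]) (simp add: N_def)
    then show ?thesis using True mu by simp
  next
    case False
    have "N \<subseteq> {..<j}"
    proof
      fix i assume "i \<in> N"
      then show "i \<in> {..<j}" using mono[of j i] False by (force simp: N_def)
    qed
    then have "card N \<le> card {..<j}" by (rule card_mono[rotated]) simp
    then show ?thesis using False mu by simp
  qed
qed

theorem theorem3p8:
  fixes n k :: nat and \<rho> :: real and x :: "real vec"
  assumes "n \<ge> 1" and "\<rho> > 0" and "x \<in> Rdown n" and "k = mu \<rho> x"
  shows "(k = 0 \<longrightarrow>
            global_minimizer (half_quad (A_mat \<rho> x)) (nonneg_sphere n) (unit_vec n 0)) \<and>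
         (1 \<le> k \<and> k \<le> n \<longrightarrow>
            (\<forall>w. global_minimizer
                    (half_quad (leading_principal_submatrix (A_mat \<rho> x) k)) (nonneg_sphere k) w \<longrightarrow>
                  global_minimizer
                    (half_quad (A_mat \<rho> x)) (nonneg_sphere n) (w @\<^sub>v 0\<^sub>v (n - k))))"
proof (intro conjI impI allI)
  have dim: "dim_vec x = n" using assms by (auto simp: Rdown_def)
  have A: "A_mat \<rho> x \<in> carrier_mat n n" using A_mat_carrier[of \<rho> x] dim by simp
  have first_row: "j < k \<longleftrightarrow> A_mat \<rho> x $$ (0, j) < 0" if "j < n" for j
    using less_mu_iff[OF assms(2) _ assms(3) that] assms(1,4) by simp
  have sym: "A_mat \<rho> x $$ (i, j) = A_mat \<rho> x $$ (j, i)" if "i < n" "j < n" for i j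
    using that dim by (simp add: A_mat_index mult_ac)
  \<comment> \<open>Lowering the row index to 0 only decreases the entry, and there
    \<open>first_row\<close> decides the sign.\<close>
  have ge_col: "0 \<le> A_mat \<rho> x $$ (i, j)" if "i < n" "j < n" "k \<le> j" for i j
    using A_mat_mono[OF assms(2,3), of 0 i j j] first_row[of j] that by simp
  have ge: "0 \<le> A_mat \<rho> x $$ (i, j)" if "i < n" "j < n" "k \<le> i \<or> k \<le> j" for i j
    using ge_col[of i j] ge_col[of j i] sym[of i j] that by auto
  {
    assume "k = 0"
    \<comment> \<open>For \<open>k\<close> = 0 the side condition of \<open>ge\<close> is always
      true, so it covers the whole matrix.\<close>
    then show "global_minimizer (half_quad (A_mat \<rho> x)) (nonneg_sphere n) (unit_vec n 0)"
      using assms ge by (intro global_minimizer_unit_vec A) (auto intro: A_mat_mono)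
  next
    fix w
    assume k: "1 \<le> k \<and> k \<le> n" and min: "global_minimizer
      (half_quad (leading_principal_submatrix (A_mat \<rho> x) k)) (nonneg_sphere k) w"
    \<comment> \<open>The leading principal submatrix is the same kind of matrix, built from the
      first \<open>k\<close> entries of \<open>x\<close>.\<close>
    let ?B = "A_mat \<rho> (vec_first x k)"
    have B: "?B \<in> carrier_mat k k" using A_mat_carrier[of \<rho> "vec_first x k"] by simp
    have BA: "?B $$ (i, j) = A_mat \<rho> x $$ (i, j)" if "i < k" "j < k" for i j
      using that k dim by (simp add: A_mat_index vec_first_def)
    have "A_mat \<rho> x $$ (0, 0) < 0" using first_row[of 0] k by simp
    then show "global_minimizer
        (half_quad (A_mat \<rho> x)) (nonneg_sphere n) (w @\<^sub>v 0\<^sub>v (n - k))"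
      using min k dim
      by (intro global_minimizer_append_zero[OF A B _ _ BA _ ge])
        (auto simp: leading_principal_submatrix_A_mat)
  }
qed

end
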